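(* Let $\nu\ge 2$ be real and let $I_\nu$ be the modified Bessel function of the first kind of order $\nu$. Then for all real $z\ge \frac{(\nu+\frac{11}{2})^6}{120}$, \begin{align*} &\left|I_\nu(z)e^{-z}\sqrt{2\pi z}-\sum_{i=0}^{5}\frac{\prod_{j=1}^{i}\left(-j+\nu-\frac12+1\right)\left(j+\nu+\frac12-1\right)}{i!\,(-2z)^i}\right|\\ &\quad\le \frac{52e^{-z}}{17\,\Gamma(\nu+\frac12)}\sum_{i=0}^{5}\left|\binom{\nu-\frac12}{i}\right|\frac{z^{\nu-\frac12}}{2^i}+\frac{e^{-z}}{2^{\nu-\frac12}\Gamma(\nu+\frac12)}z^{\nu+\frac12}\\ &\qquad+\left|\frac{(\nu^2-\frac{121}{4})(\nu^2-\frac{81}{4})(\nu^2-\frac{49}{4})(\nu^2-\frac{25}{4})(\nu^2-\frac94)(\nu^2-\frac14)}{6!\,2^{\nu-\frac12}z^6}\right|\max\left\{2^{\nu-\frac{13}{2}},1\right\}. \end{align*} In particular, for $\nu=2$ and all $z\ge\frac{(15/2)^6}{120}$, \[ \left|I_2(z)e^{-z}\sqrt{2\pi z}-1+\frac{15}{8z}-\frac{105}{128z^2}-\frac{315}{1024z^3}-\frac{10395}{32768z^4}-\frac{135135}{262144z^5}\right|\le\frac{73}{z^6}. \]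
   Context: $\binom{a}{i}=\frac{a(a-1)\cdots(a-i+1)}{i!}$ for real $a$; $\Gamma$ is the Gamma function. *)

theory Defs
  imports "HOL-Analysis.Analysis"
begin

text \<open>
  The modified Bessel function of the first kind of real order \<open>\<nu>\<close> on the positive real axis,
  by its power series.  Where \<open>\<nu> + k + 1\<close> is a pole of the Gamma function, the term vanishes,
  as it should, since \<open>Gamma\<close> is \<open>0\<close> there and \<open>x / 0 = 0\<close>.  The real power
  \<open>(z / 2) powr \<nu>\<close> is the intended one only for \<open>z > 0\<close>.
\<close>

definition bessel_I :: "real \<Rightarrow> real \<Rightarrow> real" where
  "bessel_I \<nu> z =
     (z / 2) powr \<nu> * (\<Sum>k. (z\<^sup>2 / 4) ^ k / (fact k * Gamma (\<nu> + real k + 1)))"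

end

(*
  Expanding exp (z (1 - 2 t)) in Poisson's integral of (t (1 - t))^a, a = nu - 1/2, over [0, 1] and
  evaluating the even moments as Beta values gives, after rescaling,
    Gamma (a + 1) I_nu(z) exp (- z) sqrt (2 pi z) = integral of (v (1 - v / (2 z)))^a exp (- v) over [0, 2 z].
  Replacing (1 - v / (2 z))^a by its binomial polynomial and the range by [0, infinity) turns the right-hand
  side into the asymptotic sum. On [0, z] the error is Lagrange's remainder; on [z, infinity) both integrands
  are exponentially small, since v^s exp (- v) <= z^s exp (s (v / z - 1) - v) there.
*)
theory Submission
  imports Defs
begin

section \<open>Duplication and the Gamma function at half-integers\<close>

text \<open>Legendre's duplication formula descends from the complex numbers because
  \<open>complex_of_real\<close> is injective and commutes with \<open>Gamma\<close> and
  \<open>exp\<close>.\<close>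

lemma Gamma_duplication_real:
  fixes x :: real
  assumes "x > 0"
  shows "Gamma x * Gamma (x + 1 / 2) = 2 powr (1 - 2 * x) * sqrt pi * Gamma (2 * x)"
proof -
  have nonpos: "complex_of_real x \<notin> \<int>\<^sub>\<le>\<^sub>0" "complex_of_real x + 1 / 2 \<notin> \<int>\<^sub>\<le>\<^sub>0"
    using assms by (auto elim!: nonpos_Ints_cases dest!: arg_cong[of _ _ Re])
  have "Gamma (complex_of_real x) * Gamma (complex_of_real (x + 1 / 2)) =
        exp (complex_of_real ((1 - 2 * x) * ln 2)) * complex_of_real (sqrt pi) *
        Gamma (complex_of_real (2 * x))"
    using Gamma_legendre_duplication[OF nonpos] by simp
  then have "complex_of_real (Gamma x * Gamma (x + 1 / 2)) =
        complex_of_real (exp ((1 - 2 * x) * ln 2) * sqrt pi * Gamma (2 * x))"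
    by (simp only: Gamma_complex_of_real exp_of_real) simp
  then show ?thesis
    unfolding of_real_eq_iff by (simp add: powr_def)
qed

text \<open>Duplication at k + 1/2, where the second Gamma factor is \<open>fact k\<close>. In the
  even moments this value cancels \<open>fact (2 * k)\<close> and leaves the
  \<open>4 ^ k * fact k\<close> of the Bessel series.\<close>

lemma Gamma_half_integer:
  "Gamma (real k + 1 / 2) = sqrt pi * fact (2 * k) / (4 ^ k * fact k)"
proof -
  have "Gamma (real k + 1 / 2) * Gamma (real k + 1 / 2 + 1 / 2) =
        2 powr (1 - 2 * (real k + 1 / 2)) * sqrt pi * Gamma (2 * (real k + 1 / 2))"
    by (rule Gamma_duplication_real) simp
  moreover have "Gamma (real k + 1 / 2 + 1 / 2) = fact k"
    using Gamma_fact[of k, where 'a = real] by (simp add: add.commute)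
  moreover have "Gamma (2 * (real k + 1 / 2)) = fact (2 * k)"
    using Gamma_fact[of "2 * k", where 'a = real] by (simp add: algebra_simps)
  moreover have "2 powr (1 - 2 * (real k + 1 / 2)) = 1 / 4 ^ k"
  proof -
    have "2 powr (1 - 2 * (real k + 1 / 2)) = 2 powr (- real (2 * k))"
      by simp
    also have "\<dots> = 1 / 2 ^ (2 * k)"
      unfolding powr_minus powr_realpow[OF zero_less_numeral] by (simp add: divide_inverse)
    finally show ?thesis by (simp add: power_mult)
  qed
  ultimately have "Gamma (real k + 1 / 2) * fact k = 1 / 4 ^ k * sqrt pi * fact (2 * k)"
    by (simp only:)
  then show ?thesis
    by (simp add: nonzero_divide_eq_eq nonzero_eq_divide_eq field_simps)
qed

section \<open>Moments of the weight (t (1 - t))^a\<close>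

text \<open>Since (1 - 2t)^2 = 1 - 4t(1 - t), the moment for k + 1 at exponent a combines the
  moments for k at the exponents a and a + 1; hence the induction leaves \<open>a\<close>
  arbitrary.\<close>

lemma has_integral_even_moment:
  fixes a :: real
  assumes "a \<ge> 0"
  shows "((\<lambda>t. (t * (1 - t)) powr a * (1 - 2 * t) ^ (2 * k)) has_integral
           2 powr (- 2 * a - 1) * Beta (real k + 1 / 2) (a + 1)) {0..1}"
  using assms
proof (induction k arbitrary: a)
  case 0
  \<comment> \<open>Base case: duplication at a + 1 turns B(a + 1, a + 1) into 2^(-2a - 1) B(1/2, a
    + 1).\<close>
  have dup: "Gamma (a + 1) * Gamma (a + 1 + 1 / 2) = 2 powr (1 - 2 * (a + 1)) * sqrt pi * Gamma (2 * (a + 1))"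
    by (rule Gamma_duplication_real) (use 0 in simp)
  have pos: "Gamma (2 * (a + 1)) > 0" "Gamma (a + 1 + 1 / 2) > 0" "Gamma (a + 1) > 0"
    by (rule Gamma_real_pos; use 0 in simp)+
  have "Beta (a + 1) (a + 1) = Gamma (a + 1) * Gamma (a + 1) / Gamma (2 * (a + 1))"
    by (simp add: Beta_def algebra_simps)
  also have "\<dots> = 2 powr (1 - 2 * (a + 1)) * sqrt pi * Gamma (a + 1) / Gamma (a + 1 + 1 / 2)"
    using arg_cong[OF dup, of "\<lambda>u. u * Gamma (a + 1)"] pos by (simp add: divide_simps mult_ac)
  also have "1 - 2 * (a + 1) = - 2 * a - 1"
    by (simp add: algebra_simps)
  also have "2 powr (- 2 * a - 1) * sqrt pi * Gamma (a + 1) / Gamma (a + 1 + 1 / 2)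
      = 2 powr (- 2 * a - 1) * Beta (1 / 2) (a + 1)"
    unfolding Beta_def by (simp add: Gamma_one_half_real add_ac)
  finally have B: "Beta (a + 1) (a + 1) = 2 powr (- 2 * a - 1) * Beta (1 / 2) (a + 1)" .
  have "((\<lambda>t. t powr (a + 1 - 1) * (1 - t) powr (a + 1 - 1)) has_integral Beta (a + 1) (a + 1)) {0..1}"
    by (rule has_integral_Beta_real) (use 0 in auto)
  then show ?case
    unfolding B by (auto simp: powr_mult elim!: has_integral_eq[rotated])
next
  case (Suc k)
  have int: "((\<lambda>t. (t * (1 - t)) powr a * (1 - 2 * t) ^ (2 * k)
            - 4 * ((t * (1 - t)) powr (a + 1) * (1 - 2 * t) ^ (2 * k))) has_integral
          2 powr (- 2 * a - 1) * Beta (real k + 1 / 2) (a + 1)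
            - 4 * (2 powr (- 2 * (a + 1) - 1) * Beta (real k + 1 / 2) (a + 1 + 1))) {0..1}"
    by (intro has_integral_diff has_integral_mult_right Suc.IH) (use Suc.prems in auto)
  \<comment> \<open>The factor 4 offsets the shift in the exponent of 2, so both Beta values carry
    the same prefactor and B(x, y) - B(x, y + 1) = B(x + 1, y) applies.\<close>
  have val: "2 powr (- 2 * a - 1) * Beta (real k + 1 / 2) (a + 1)
            - 4 * (2 powr (- 2 * (a + 1) - 1) * Beta (real k + 1 / 2) (a + 1 + 1))
        = 2 powr (- 2 * a - 1) * Beta (real (Suc k) + 1 / 2) (a + 1)"
  proof -
    have "2 powr (- 2 * a - 1) = 2 powr (- 2 * (a + 1) - 1) * 2 powr (2::real)"
      unfolding powr_add[symmetric] by (rule arg_cong[where f = "(powr) 2"]) simp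
    then have four: "4 * 2 powr (- 2 * (a + 1) - 1) = 2 powr (- 2 * a - 1)"
      by simp
    have "Beta (real k + 1 / 2 + 1) (a + 1) + Beta (real k + 1 / 2) (a + 1 + 1)
        = Beta (real k + 1 / 2) (a + 1)"
      by (rule Beta_plus1_plus1) (use Suc.prems in \<open>auto elim!: nonpos_Ints_cases\<close>)
    then have "Beta (real k + 1 / 2) (a + 1) - Beta (real k + 1 / 2) (a + 1 + 1)
        = Beta (real (Suc k) + 1 / 2) (a + 1)"
      by (simp add: add_ac)
    then show ?thesis
      unfolding mult.assoc[symmetric] four right_diff_distrib[symmetric] by simp
  qed
  have "(t * (1 - t)) powr a * (1 - 2 * t) ^ (2 * k)
            - 4 * ((t * (1 - t)) powr (a + 1) * (1 - 2 * t) ^ (2 * k))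
      = (t * (1 - t)) powr a * (1 - 2 * t) ^ (2 * Suc k)" if "t \<in> {0..1}" for t :: real
  proof -
    have "(t * (1 - t)) powr (a + 1) = (t * (1 - t)) powr a * (t * (1 - t))"
      using that by (cases "t * (1 - t) = 0") (auto simp: powr_add mult_less_0_iff)
    moreover have "(1 - 2 * t) ^ (2 * Suc k) = (1 - 2 * t) ^ (2 * k) * (1 - 4 * (t * (1 - t)))"
      by (simp add: power2_eq_square algebra_simps)
    ultimately show ?thesis
      by (simp only:) (simp add: algebra_simps del: mult_Suc_right)
  qed
  from has_integral_eq[OF this int] show ?case
    unfolding val .
qed

text \<open>Positivity of \<open>a\<close> matters at the endpoints: under
  \<open>0 powr 0 = 0\<close> the weight for a = 0 would jump there.\<close>

lemma continuous_on_weight: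
  fixes a :: real
  assumes "a > 0"
  shows "continuous_on {0..1} (\<lambda>t. (t * (1 - t)) powr a)"
  by (intro continuous_on_powr' continuous_intros) (use assms in auto)

text \<open>The reflection of t to 1 - t keeps the weight and negates the odd power, so the integral
  equals its own negative.\<close>

lemma has_integral_odd_moment:
  fixes a :: real
  assumes "a > 0"
  shows "((\<lambda>t. (t * (1 - t)) powr a * (1 - 2 * t) ^ Suc (2 * k)) has_integral 0) {0..1}"
proof -
  let ?f = "\<lambda>t. (t * (1 - t)) powr a * (1 - 2 * t) ^ Suc (2 * k)"
  have "?f integrable_on {0..1}"
    by (intro integrable_continuous_interval continuous_intros continuous_on_weight assms)
  then obtain I where I: "(?f has_integral I) {0..1}"
    by blast
  then have "((\<lambda>t. ?f (-1 *\<^sub>R t + 1)) has_integral I) {0..1}"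
    using has_integral_affinity[of ?f I 0 1 "-1" 1] by (auto simp: image_affinity_atLeastAtMost)
  moreover have "?f (-1 *\<^sub>R t + 1) = - ?f t" for t
  proof -
    have "1 - 2 * (1 - t) = - (1 - 2 * t)" by simp
    then have "(1 - 2 * (1 - t)) ^ Suc (2 * k) = - ((1 - 2 * t) ^ Suc (2 * k))"
      by (metis power_minus_odd even_Suc dvd_triv_left)
    then show ?thesis by (simp add: mult_ac)
  qed
  ultimately have "((\<lambda>t. - ?f t) has_integral I) {0..1}"
    by (simp only:)
  from has_integral_neg[OF this] have "(?f has_integral - I) {0..1}"
    by (simp only: minus_minus)
  with I have "I = - I"
    by (rule has_integral_unique)
  with I show ?thesis by simp
qed

section \<open>Poisson's integral for the Bessel function\<close>

text \<open>Termwise integration of the exponential series: odd powers contribute nothing, and even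
  ones give, up to the factor \<open>c\<close>, the power series in \<open>bessel_I\<close> for
  \<nu> = a + 1/2.\<close>

lemma has_integral_bessel_series:
  fixes a z :: real
  assumes a: "a > 0"
  shows "((\<lambda>t. (t * (1 - t)) powr a * exp (z * (1 - 2 * t))) has_integral
           2 powr (- 2 * a - 1) * sqrt pi * Gamma (a + 1) *
           (\<Sum>k. (z\<^sup>2 / 4) ^ k / (fact k * Gamma (a + 1 / 2 + real k + 1)))) {0..1}"
proof -
  define w where "w = (\<lambda>t::real. (t * (1 - t)) powr a)"
  define f where "f = (\<lambda>n t. w t * (z * (1 - 2 * t)) ^ n / fact n)"
  define c where "c = 2 powr (- 2 * a - 1) * sqrt pi * Gamma (a + 1)"
  have w: "continuous_on {0..1} w"
    unfolding w_def by (rule continuous_on_weight[OF a])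
  have w1: "0 \<le> w t \<and> w t \<le> 1" if "t \<in> {0..1}" for t
    using that a unfolding w_def by (auto intro!: powr_le1 mult_le_one)
  have even: "(f (2 * k) has_integral c * ((z\<^sup>2 / 4) ^ k / (fact k * Gamma (a + 1 / 2 + real k + 1)))) {0..1}" for k
  proof -
    have "((\<lambda>t. z ^ (2 * k) / fact (2 * k) * ((t * (1 - t)) powr a * (1 - 2 * t) ^ (2 * k))) has_integral
            z ^ (2 * k) / fact (2 * k) * (2 powr (- 2 * a - 1) * Beta (real k + 1 / 2) (a + 1))) {0..1}"
      by (intro has_integral_mult_right has_integral_even_moment) (use a in simp)
    moreover have "z ^ (2 * k) / fact (2 * k) * (2 powr (- 2 * a - 1) * Beta (real k + 1 / 2) (a + 1))
        = c * ((z\<^sup>2 / 4) ^ k / (fact k * Gamma (a + 1 / 2 + real k + 1)))"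
      unfolding c_def Beta_def Gamma_half_integer
      by (simp add: power_divide add_ac field_simps flip: power_mult)
    moreover have "(\<lambda>t. z ^ (2 * k) / fact (2 * k) * ((t * (1 - t)) powr a * (1 - 2 * t) ^ (2 * k))) = f (2 * k)"
      by (simp add: fun_eq_iff f_def w_def power_mult_distrib)
    ultimately show ?thesis by simp
  qed
  have odd: "(f (Suc (2 * k)) has_integral 0) {0..1}" for k
  proof -
    have "((\<lambda>t. z ^ Suc (2 * k) / fact (Suc (2 * k)) * ((t * (1 - t)) powr a * (1 - 2 * t) ^ Suc (2 * k))) has_integral
            z ^ Suc (2 * k) / fact (Suc (2 * k)) * 0) {0..1}"
      by (intro has_integral_mult_right has_integral_odd_moment a)
    moreover have "(\<lambda>t. z ^ Suc (2 * k) / fact (Suc (2 * k)) * ((t * (1 - t)) powr a * (1 - 2 * t) ^ Suc (2 * k))) = f (Suc (2 * k))"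
      unfolding fun_eq_iff f_def w_def power_mult_distrib by simp
    ultimately show ?thesis by (simp only: mult_zero_right)
  qed
  \<comment> \<open>The weight and |1 - 2t| are at most 1 on [0, 1], so the exponential series of
    |z| is a majorant; uniform convergence permits exchanging sum and integral.\<close>
  have "uniform_limit {0..1} (\<lambda>n t. \<Sum>k<n. f k t) (\<lambda>t. \<Sum>k. f k t) sequentially"
  proof (rule Weierstrass_m_test)
    show "summable (\<lambda>n. \<bar>z\<bar> ^ n / fact n)"
      using summable_exp[of "\<bar>z\<bar>"] by (simp add: field_simps)
    show "norm (f n t) \<le> \<bar>z\<bar> ^ n / fact n" if "t \<in> {0..1}" for n t
    proof -
      have "\<bar>1 - 2 * t\<bar> ^ n \<le> 1"
        using that by (intro power_le_one) auto
      then have "w t * (\<bar>z\<bar> ^ n * \<bar>1 - 2 * t\<bar> ^ n) \<le> 1 * (\<bar>z\<bar> ^ n * 1)"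
        using w1[OF that] by (intro mult_mono) auto
      then show ?thesis
        using w1[OF that] by (simp add: f_def abs_mult power_abs power_mult_distrib divide_right_mono)
    qed
  qed
  then obtain I J where IJ: "\<And>n. ((\<lambda>t. \<Sum>k<n. f k t) has_integral I n) {0..1}"
      "((\<lambda>t. \<Sum>k. f k t) has_integral J) {0..1}" "I \<longlonglongrightarrow> J"
    by (rule uniform_limit_integral) (use w in \<open>auto simp: f_def intro!: continuous_intros\<close>)
  have I: "I = (\<lambda>n. \<Sum>k<n. integral {0..1} (f k))"
  proof
    fix n
    have "f k integrable_on {0..1}" for k
      unfolding f_def by (intro integrable_continuous_interval continuous_intros w) auto
    then have "((\<lambda>t. \<Sum>k<n. f k t) has_integral (\<Sum>k<n. integral {0..1} (f k))) {0..1}"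
      by (intro has_integral_sum) (auto intro: integrable_integral)
    with IJ(1) show "I n = (\<Sum>k<n. integral {0..1} (f k))" by (rule has_integral_unique)
  qed
  have "(\<lambda>k. integral {0..1} (f k)) sums J"
    using IJ(3) unfolding I sums_def .
  \<comment> \<open>Only even indices contribute, so the series can be reindexed along the doubling
    map.\<close>
  moreover have "integral {0..1} (f n) = 0" if "n \<notin> range (\<lambda>k. 2 * k)" for n
  proof -
    have "odd n" using that by (auto elim!: evenE)
    then obtain k where "n = Suc (2 * k)" by (auto elim!: oddE)
    with odd[of k] show ?thesis by (simp add: integral_unique)
  qed
  moreover have "strict_mono (\<lambda>k::nat. 2 * k)"
    by (simp add: strict_mono_def)
  ultimately have "(\<lambda>k. integral {0..1} (f (2 * k))) sums J"
    using sums_mono_reindex[of "\<lambda>k. 2 * k" "\<lambda>k. integral {0..1} (f k)"] by blast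
  then have S: "(\<lambda>k. c * ((z\<^sup>2 / 4) ^ k / (fact k * Gamma (a + 1 / 2 + real k + 1)))) sums J"
    using integral_unique[OF even] by simp
  \<comment> \<open>A nonzero \<open>c\<close> lets summability pass from the scaled series to the
    Bessel series, so that \<open>c\<close> can be taken out of \<open>suminf\<close>.\<close>
  have "c > 0"
    unfolding c_def using a by (auto intro!: mult_pos_pos Gamma_real_pos)
  then have "J = c * (\<Sum>k. (z\<^sup>2 / 4) ^ k / (fact k * Gamma (a + 1 / 2 + real k + 1)))"
    using S suminf_mult[OF summable_mult_D[OF sums_summable[OF S]], of c] by (simp add: sums_iff)
  moreover have "(\<Sum>k. f k t) = w t * exp (z * (1 - 2 * t))" for t
  proof -
    have "(\<lambda>k. w t * ((z * (1 - 2 * t)) ^ k /\<^sub>R fact k)) sums (w t * exp (z * (1 - 2 * t)))"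
      by (intro sums_mult exp_converges)
    then show ?thesis
      by (simp add: f_def sums_iff divide_inverse mult_ac)
  qed
  ultimately show ?thesis
    using IJ(2) by (simp add: w_def c_def)
qed

text \<open>Substituting v = 2zt in Poisson's integral and multiplying by (2z)^a exp(-z) turns
  exp(z(1 - 2t)) into exp(-v). The range [0, 2z] fills [0, infinity) as z grows, which suggests
  comparison with Euler's integral.\<close>

lemma has_integral_bessel_I:
  fixes \<nu> z :: real
  assumes \<nu>: "\<nu> > 1 / 2" and z: "z > 0"
  shows "((\<lambda>v. (v * (1 - v / (2 * z))) powr (\<nu> - 1 / 2) * exp (- v)) has_integral
           Gamma (\<nu> + 1 / 2) * (bessel_I \<nu> z * exp (- z) * sqrt (2 * pi * z))) {0..2 * z}"
proof -
  define a where "a = \<nu> - 1 / 2"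
  define S where "S = (\<Sum>k. (z\<^sup>2 / 4) ^ k / (fact k * Gamma (\<nu> + real k + 1)))"
  have a: "a > 0" "\<nu> = a + 1 / 2" using \<nu> by (auto simp: a_def)
  have "((\<lambda>t. (t * (1 - t)) powr a * exp (z * (1 - 2 * t))) has_integral
          2 powr (- 2 * a - 1) * sqrt pi * Gamma (a + 1) * S) {0..1}"
    using has_integral_bessel_series[OF a(1), of z] by (simp add: S_def a(2))
  from has_integral_stretch_real[OF this, of "1 / (2 * z)"]
  have "((\<lambda>v. (v / (2 * z) * (1 - v / (2 * z))) powr a * exp (z * (1 - 2 * (v / (2 * z))))) has_integral
          2 * z * (2 powr (- 2 * a - 1) * sqrt pi * Gamma (a + 1) * S)) {0..2 * z}"
    using z by (simp add: mult.commute[of _ "2 * z"] image_mult_atLeastAtMost)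
  from has_integral_mult_right[OF this, of "(2 * z) powr a * exp (- z)"]
  have int: "((\<lambda>v. (2 * z) powr a * exp (- z) * ((v / (2 * z) * (1 - v / (2 * z))) powr a * exp (z * (1 - 2 * (v / (2 * z)))))) has_integral
          (2 * z) powr a * exp (- z) * (2 * z * (2 powr (- 2 * a - 1) * sqrt pi * Gamma (a + 1) * S))) {0..2 * z}" .
  have eq: "(2 * z) powr a * exp (- z) * ((v / (2 * z) * (1 - v / (2 * z))) powr a * exp (z * (1 - 2 * (v / (2 * z)))))
      = (v * (1 - v / (2 * z))) powr a * exp (- v)" if "v \<in> {0..2 * z}" for v
  proof -
    have "v / (2 * z) * (1 - v / (2 * z)) \<ge> 0"
      using that z by (intro mult_nonneg_nonneg) auto
    then have "(2 * z) powr a * (v / (2 * z) * (1 - v / (2 * z))) powr a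
        = (2 * z * (v / (2 * z) * (1 - v / (2 * z)))) powr a"
      using z by (subst powr_mult) auto
    also have "2 * z * (v / (2 * z) * (1 - v / (2 * z))) = v * (1 - v / (2 * z))"
      using z by simp
    finally have "(2 * z) powr a * (v / (2 * z) * (1 - v / (2 * z))) powr a = (v * (1 - v / (2 * z))) powr a" .
    moreover have "exp (- z) * exp (z * (1 - 2 * (v / (2 * z)))) = exp (- v)"
      unfolding exp_add[symmetric] using z by (simp add: field_simps)
    ultimately show ?thesis
      by (simp only: mult.assoc mult.left_commute[of "exp (- z)"]) (simp only: flip: mult.assoc)
  qed
  have val: "(2 * z) powr a * exp (- z) * (2 * z * (2 powr (- 2 * a - 1) * sqrt pi * Gamma (a + 1) * S))
      = Gamma (\<nu> + 1 / 2) * (bessel_I \<nu> z * exp (- z) * sqrt (2 * pi * z))"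
  proof -
    \<comment> \<open>The prefactors collect to (2z)^(a+1) 2^(-2a-1) = z^(a+1) 2^(-a) = (z/2)^\<nu>
      sqrt(2z), which contains the leading factor of \<open>bessel_I\<close>.\<close>
    have "(2 * z) powr a * (2 * z) * 2 powr (- 2 * a - 1) = z powr (a + 1) * 2 powr (- a)"
      using z by (simp add: powr_mult powr_add powr_minus powr_diff field_simps)
        (simp add: powr_add[symmetric] mult_ac)
    also have "\<dots> = (z / 2) powr \<nu> * sqrt (2 * z)"
    proof -
      have "sqrt (2 * z) = 2 powr (1 / 2) * z powr (1 / 2)"
        using z by (simp add: powr_half_sqrt real_sqrt_mult)
      then have "(z / 2) powr \<nu> * sqrt (2 * z) = (z powr (a + 1 / 2) * z powr (1 / 2)) * (2 powr (- (a + 1 / 2)) * 2 powr (1 / 2))"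
        unfolding a(2) powr_minus_divide[of 2 "a + 1 / 2"] using z by (subst powr_divide) auto
      then show ?thesis
        unfolding powr_add[symmetric] by (simp add: add.commute)
    qed
    finally have "(2 * z) powr a * (2 * z) * 2 powr (- 2 * a - 1) = (z / 2) powr \<nu> * sqrt (2 * z)" .
    then have "(2 * z) powr a * (2 * z) * 2 powr (- 2 * a - 1) * (exp (- z) * sqrt pi * Gamma (a + 1) * S)
        = (z / 2) powr \<nu> * sqrt (2 * z) * (exp (- z) * sqrt pi * Gamma (a + 1) * S)"
      by simp
    then show ?thesis
      unfolding bessel_I_def S_def[symmetric]
      by (simp add: a real_sqrt_mult mult_ac add_ac)
  qed
  show ?thesis
    unfolding a_def[symmetric] by (rule has_integral_eq[OF _ int[unfolded val]]) (rule eq)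
qed

section \<open>Binomial remainder and exponential tails\<close>

text \<open>Lagrange's remainder for (1 - s)^a at s = 0; t < 1 keeps the base positive on [0, t]. At
  t = 0, which \<open>Maclaurin\<close> excludes, only the term i = 0 survives and \<xi> = 0
  serves.\<close>

lemma powr_binomial_Taylor:
  fixes a t :: real and n :: nat
  assumes t: "0 \<le> t" "t < 1" and n: "n > 0"
  obtains \<xi> where "0 \<le> \<xi>" "\<xi> \<le> t"
    "(1 - t) powr a = (\<Sum>i<n. (a gchoose i) * (- t) ^ i)
       + (a gchoose n) * (- t) ^ n * (1 - \<xi>) powr (a - real n)"
proof (cases "t = 0")
  case True
  have "(\<Sum>i<n. (a gchoose i) * (- t) ^ i) = (\<Sum>i\<in>{0}. (a gchoose i) * (- t) ^ i)"
    using n True by (intro sum.mono_neutral_right) (auto simp: power_0_left)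
  with True n show ?thesis
    by (intro that[of 0]) auto
next
  case False
  \<comment> \<open>\<open>d m\<close> is the m-th derivative of (1 - s)^a:
    \<open>fact m * (a gchoose m)\<close> is a falling factorial, and the sign comes from the inner
    derivative -1.\<close>
  define d where "d = (\<lambda>m s. (- 1) ^ m * fact m * (a gchoose m) * (1 - s) powr (a - real m))"
  have "\<exists>\<xi>. 0 < \<xi> \<and> \<xi> < t \<and>
      (1 - t) powr a = (\<Sum>m<n. d m 0 / fact m * t ^ m) + d n \<xi> / fact n * t ^ n"
  proof (rule Maclaurin)
    show "d 0 = (\<lambda>t. (1 - t) powr a)" by (simp add: d_def fun_eq_iff)
    show "\<forall>m s. m < n \<and> 0 \<le> s \<and> s \<le> t \<longrightarrow> (d m has_real_derivative d (Suc m) s) (at s)"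
    proof (intro allI impI)
      fix m s assume "m < n \<and> 0 \<le> s \<and> s \<le> t"
      then have s: "s < 1" using t by simp
      have g: "fact (Suc m) * (a gchoose Suc m) = fact m * (a gchoose m) * (a - real m)"
        unfolding gbinomial_mult_fact by simp
      have "d (Suc m) s = - ((- 1) ^ m) * (fact (Suc m) * (a gchoose Suc m)) * (1 - s) powr (a - real m - 1)"
        by (simp add: d_def algebra_simps)
      then show "(d m has_real_derivative d (Suc m) s) (at s)"
        unfolding g unfolding d_def using s by (auto intro!: derivative_eq_intros simp: mult_ac)
    qed
  qed (use False t n in auto)
  then obtain \<xi> where \<xi>: "0 < \<xi>" "\<xi> < t"
    "(1 - t) powr a = (\<Sum>m<n. d m 0 / fact m * t ^ m) + d n \<xi> / fact n * t ^ n" by blast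
  have "(1 - t) powr a = (\<Sum>i<n. (a gchoose i) * (- t) ^ i)
       + (a gchoose n) * (- t) ^ n * (1 - \<xi>) powr (a - real n)"
    unfolding \<xi>(3) power_minus[of t] by (simp add: d_def mult_ac)
  with \<xi> show ?thesis
    by (intro that[of \<xi>]) auto
qed


text \<open>The inequality 1 + x \<le> exp x at x = v/z - 1, raised to the power s, trades the power
  of v for an exponential that is exact at v = z and elementary to integrate.\<close>

lemma powr_exp_tail_bound:
  fixes s z v :: real
  assumes "s \<ge> 0" "z > 0" "v \<ge> z"
  shows "v powr s * exp (- v) \<le> z powr s * (exp (- s) * exp (- (1 - s / z) * v))"
proof -
  have "v / z \<le> exp (v / z - 1)"
    using exp_ge_add_one_self[of "v / z - 1"] by simp
  then have "(v / z) powr s \<le> exp (v / z - 1) powr s"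
    using assms by (intro powr_mono2) auto
  also have "\<dots> = exp (s * (v / z - 1))"
    by (simp add: powr_def)
  finally have "v powr s \<le> z powr s * exp (s * (v / z - 1))"
    using assms by (simp add: powr_divide field_simps)
  then have "v powr s * exp (- v) \<le> z powr s * exp (s * (v / z - 1)) * exp (- v)"
    by simp
  also have "\<dots> = z powr s * (exp (- s) * exp (- (1 - s / z) * v))"
    unfolding mult.assoc exp_add[symmetric] by (simp add: algebra_simps)
  finally show ?thesis .
qed

text \<open>The rate 1 - s/z is positive because s < z, and at v = z the exponentials combine to
  exp(-z). Extension by 0 puts the tail on the same domain as Euler's integrals.\<close>

lemma has_integral_exp_tail:
  fixes s z :: real
  assumes "s < z" "z > 0"
  shows "((\<lambda>v. if v \<in> {z..} then exp (- s) * exp (- (1 - s / z) * v) else 0) has_integral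
           exp (- z) * (z / (z - s))) {0..}"
proof -
  have "((\<lambda>v. exp (- s) * exp (- (1 - s / z) * v)) has_integral
          exp (- s) * (exp (- (1 - s / z) * z) / (1 - s / z))) {z..}"
    by (intro has_integral_mult_right has_integral_exp_minus_to_infinity) (use assms in simp)
  moreover have "exp (- s) * (exp (- (1 - s / z) * z) / (1 - s / z)) = exp (- z) * (z / (z - s))"
  proof -
    have "exp (- s) * exp (- (1 - s / z) * z) = exp (- z)"
      unfolding exp_add[symmetric] using assms by (simp add: field_simps)
    moreover have "1 / (1 - s / z) = z / (z - s)"
      using assms by (simp add: field_simps)
    ultimately show ?thesis
      by (metis times_divide_eq_right mult.right_neutral)
  qed
  moreover have "{z..} \<subseteq> {0..}" using assms by auto
  ultimately show ?thesis
    by (simp only: has_integral_restrict)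
qed

text \<open>A power is monotone in its base, so the extremes lie at \<xi> = 0 and \<xi> = 1/2, with
  values 1 and 2^(-p).\<close>

lemma one_minus_powr_le:
  fixes \<xi> p :: real
  assumes "0 \<le> \<xi>" "\<xi> \<le> 1 / 2"
  shows "(1 - \<xi>) powr p \<le> max 1 (2 powr (- p))"
proof (cases "p \<ge> 0")
  case True
  then have "(1 - \<xi>) powr p \<le> 1"
    using assms by (intro powr_le1) auto
  then show ?thesis by simp
next
  case False
  then have "(1 - \<xi>) powr p \<le> (1 / 2) powr p"
    using assms by (intro powr_mono2') auto
  also have "\<dots> = 2 powr (- p)"
    by (simp add: powr_divide powr_minus_divide)
  finally show ?thesis by simp
qed

section \<open>The error after n terms\<close>

text \<open>
  With \<open>g\<close> the difference of the two integrands, extended by \<open>0\<close> beyond \<open>2 * z\<close> in its first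
  part, the single dominating function \<open>h\<close> is Taylor's remainder on all of \<open>[0, \<infinity>)\<close> plus, on
  \<open>[z, \<infinity>)\<close>, a bound for each of the two parts separately.
\<close>

lemma bessel_I_asymptotic_error:
  fixes a z :: real and n :: nat
  assumes a: "a > 0" and n: "n > 0" and z: "z > 0" "z > a + real n - 1"
  shows "\<bar>Gamma (a + 1) * (bessel_I (a + 1 / 2) z * exp (- z) * sqrt (2 * pi * z))
           - (\<Sum>i<n. (a gchoose i) * (- 1 / (2 * z)) ^ i * Gamma (a + real i + 1))\<bar>
     \<le> (\<Sum>i<n. \<bar>a gchoose i\<bar> * (z powr a / 2 ^ i) * (exp (- z) * (z / (z - (a + real i)))))
       + (z / 2) powr a * exp (- z)
       + \<bar>a gchoose n\<bar> / (2 * z) ^ n * max 1 (2 powr (real n - a)) * Gamma (a + real n + 1)"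
proof -
  \<comment> \<open>\<open>c i\<close> is the coefficient of v^i in the binomial expansion of (1 -
    v/(2z))^a.\<close>
  define c where "c = (\<lambda>i. (a gchoose i) * (- 1 / (2 * z)) ^ i)"
  define M where "M = \<bar>a gchoose n\<bar> / (2 * z) ^ n * max 1 (2 powr (real n - a))"
  define A where "A = (\<lambda>v. (v * (1 - v / (2 * z))) powr a * exp (- v))"
  define E where "E = (\<lambda>s v. if v \<in> {z..} then exp (- s) * exp (- (1 - s / z) * v) else 0)"
  \<comment> \<open>The exponents ending in \<open>+ 1 - 1\<close> and the divisor
    \<open>exp v\<close> reproduce the form of Euler's integral in
    \<open>Gamma_integral_real\<close>.\<close>
  define g where "g = (\<lambda>v. (if v \<in> {0..2 * z} then A v else 0)
                     - (\<Sum>i<n. c i * (v powr (a + real i + 1 - 1) / exp v)))"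
  define h where "h = (\<lambda>v. (\<Sum>i<n. \<bar>a gchoose i\<bar> * (z powr a / 2 ^ i) * E (a + real i) v)
                     + (z / 2) powr a * E 0 v + M * (v powr (a + real n + 1 - 1) / exp v))"
  have M0: "M \<ge> 0" using z by (simp add: M_def)
  have E0: "E s v \<ge> 0" for s v by (simp add: E_def)
  have c_abs: "\<bar>c i\<bar> * z powr (a + real i) = \<bar>a gchoose i\<bar> * (z powr a / 2 ^ i)" for i
    using z by (simp add: c_def abs_mult power_abs powr_add powr_realpow power_mult_distrib power_divide)
  have g: "(g has_integral Gamma (a + 1) * (bessel_I (a + 1 / 2) z * exp (- z) * sqrt (2 * pi * z))
        - (\<Sum>i<n. c i * Gamma (a + real i + 1))) {0..}"
    unfolding g_def
  proof (intro has_integral_diff has_integral_sum has_integral_mult_right Gamma_integral_real)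
    have "{0..2 * z} \<subseteq> {0..}" by auto
    moreover have "(A has_integral Gamma (a + 1) * (bessel_I (a + 1 / 2) z * exp (- z) * sqrt (2 * pi * z))) {0..2 * z}"
      using has_integral_bessel_I[of "a + 1 / 2" z] a z(1) unfolding A_def by (simp add: add.commute)
    ultimately show "((\<lambda>v. if v \<in> {0..2 * z} then A v else 0) has_integral
        Gamma (a + 1) * (bessel_I (a + 1 / 2) z * exp (- z) * sqrt (2 * pi * z))) {0..}"
      by (simp only: has_integral_restrict)
  qed (use a in auto)
  have "(E 0 has_integral exp (- z) * (z / (z - 0))) {0..}"
    unfolding E_def by (rule has_integral_exp_tail) (use z in auto)
  then have E00: "(E 0 has_integral exp (- z)) {0..}"
    using z by simp
  have h: "(h has_integral
         (\<Sum>i<n. \<bar>a gchoose i\<bar> * (z powr a / 2 ^ i) * (exp (- z) * (z / (z - (a + real i)))))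
       + (z / 2) powr a * exp (- z) + M * Gamma (a + real n + 1)) {0..}"
    unfolding h_def
  proof (intro has_integral_add has_integral_sum has_integral_mult_right Gamma_integral_real E00)
    \<comment> \<open>The largest exponent is a + n - 1, so the hypothesis on z puts every a + i
      below z and each tail decays.\<close>
    fix i assume "i \<in> {..<n}"
    then show "(E (a + real i) has_integral exp (- z) * (z / (z - (a + real i)))) {0..}"
      unfolding E_def using z n by (intro has_integral_exp_tail) auto
  qed (use a in auto)
  have le: "\<bar>g v\<bar> \<le> h v" if v: "v \<in> {0..}" for v
  proof (cases "v \<le> z")
    case True
    \<comment> \<open>Below z, Taylor's formula applies at t = v/(2z) \<le> 1/2, and subtracting the
      polynomial leaves exactly the remainder.\<close>
    define t where "t = v / (2 * z)"
    have t: "0 \<le> t" "t \<le> 1 / 2" "t < 1" and vt: "v \<in> {0..2 * z}"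
      using True v z by (auto simp: t_def field_simps)
    obtain \<xi> where \<xi>: "0 \<le> \<xi>" "\<xi> \<le> t"
      "(1 - t) powr a = (\<Sum>i<n. (a gchoose i) * (- t) ^ i)
       + (a gchoose n) * (- t) ^ n * (1 - \<xi>) powr (a - real n)"
      using powr_binomial_Taylor[OF t(1,3) n] by blast
    have A: "A v = v powr a * exp (- v) * (1 - t) powr a"
      unfolding A_def t_def[symmetric] using t v by (subst powr_mult) auto
    have "(\<Sum>i<n. c i * (v powr (a + real i + 1 - 1) / exp v))
        = v powr a * exp (- v) * (\<Sum>i<n. (a gchoose i) * (- t) ^ i)"
      unfolding sum_distrib_left
    proof (rule sum.cong[OF refl])
      fix i
      have vi: "v powr (a + real i + 1 - 1) = v powr a * v ^ i"
        using v a by (cases "v = 0") (auto simp: powr_add powr_realpow)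
      have ti: "(- t) ^ i = (- 1 / (2 * z)) ^ i * v ^ i"
        unfolding power_mult_distrib[symmetric] by (simp add: t_def)
      show "c i * (v powr (a + real i + 1 - 1) / exp v) = v powr a * exp (- v) * ((a gchoose i) * (- t) ^ i)"
        unfolding vi ti c_def exp_minus divide_inverse[of _ "exp v"] by (simp only: mult_ac)
    qed
    then have "g v = v powr a * exp (- v) * ((a gchoose n) * (- t) ^ n * (1 - \<xi>) powr (a - real n))"
      unfolding g_def using vt by (simp add: A \<xi>(3) algebra_simps)
    then have "\<bar>g v\<bar> = v powr a * exp (- v) * (\<bar>a gchoose n\<bar> * t ^ n) * (1 - \<xi>) powr (a - real n)"
      using t by (simp add: abs_mult power_abs)
    also have "\<dots> \<le> v powr a * exp (- v) * (\<bar>a gchoose n\<bar> * t ^ n) * max 1 (2 powr (- (a - real n)))"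
      using one_minus_powr_le[of \<xi> "a - real n"] \<xi> t by (intro mult_left_mono) auto
    also have "\<dots> = M * (v powr (a + real n + 1 - 1) / exp v)"
    proof -
      have vn: "v powr (a + real n + 1 - 1) = v powr a * v ^ n"
        using v a by (cases "v = 0") (auto simp: powr_add powr_realpow)
      have tn: "t ^ n = v ^ n * inverse ((2 * z) ^ n)"
        by (simp only: t_def power_divide divide_inverse[of "v ^ n"])
      show ?thesis
        unfolding vn tn M_def exp_minus divide_inverse minus_diff_eq by (simp only: mult_ac)
    qed
    also have "\<dots> \<le> h v"
      unfolding h_def using E0 by (auto intro!: add_nonneg_nonneg sum_nonneg mult_nonneg_nonneg)
    finally show ?thesis .
  next
    case False
    then have vz: "v \<ge> z" by simp
    have "\<bar>if v \<in> {0..2 * z} then A v else 0\<bar> \<le> (z / 2) powr a * E 0 v"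
    proof (cases "v \<in> {0..2 * z}")
      case True
      \<comment> \<open>Completing the square shows that the base peaks at v = z with value
        z/2.\<close>
      have "v * (1 - v / (2 * z)) = z / 2 - (v - z)\<^sup>2 / (2 * z)"
        using z by (simp add: field_simps power2_eq_square)
      also have "\<dots> \<le> z / 2"
        using z by simp
      finally have "(v * (1 - v / (2 * z))) powr a \<le> (z / 2) powr a"
        using True z a by (intro powr_mono2 mult_nonneg_nonneg) auto
      with True vz show ?thesis by (simp add: A_def E_def abs_mult)
    qed (use E0 in auto)
    moreover have "\<bar>\<Sum>i<n. c i * (v powr (a + real i + 1 - 1) / exp v)\<bar>
        \<le> (\<Sum>i<n. \<bar>a gchoose i\<bar> * (z powr a / 2 ^ i) * E (a + real i) v)"
    proof (rule order_trans[OF sum_abs], rule sum_mono)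
      fix i
      have "\<bar>c i * (v powr (a + real i + 1 - 1) / exp v)\<bar> = \<bar>c i\<bar> * (v powr (a + real i) * exp (- v))"
        by (simp add: abs_mult exp_minus divide_inverse)
      also have "\<dots> \<le> \<bar>c i\<bar> * (z powr (a + real i) * (exp (- (a + real i)) * exp (- (1 - (a + real i) / z) * v)))"
        using a z vz by (intro mult_left_mono powr_exp_tail_bound) auto
      also have "\<dots> = \<bar>a gchoose i\<bar> * (z powr a / 2 ^ i) * E (a + real i) v"
        unfolding mult.assoc[symmetric] c_abs using vz by (simp add: E_def)
      finally show "\<bar>c i * (v powr (a + real i + 1 - 1) / exp v)\<bar>
        \<le> \<bar>a gchoose i\<bar> * (z powr a / 2 ^ i) * E (a + real i) v" .
    qed
    moreover have "M * (v powr (a + real n + 1 - 1) / exp v) \<ge> 0"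
      using M0 by simp
    ultimately show ?thesis
      unfolding g_def h_def by linarith
  qed
  have "norm (integral {0..} g) \<le> integral {0..} h"
    by (rule integral_norm_bound_integral) (use g h le in auto)
  then show ?thesis
    unfolding integral_unique[OF g] integral_unique[OF h] by (simp add: c_def M_def)
qed

section \<open>The expansion with six terms\<close>

text \<open>From i to i + 1 the binomial coefficient gains (a - i)/(i + 1) and the Gamma value a + i
  + 1: together the next factor of the product over the next factor of the factorial. For i < 6 this
  yields the asymptotic coefficients, for i = 6 the polynomial in the remainder.\<close>

lemma gbinomial_mult_Gamma:
  fixes a :: real
  assumes "a > - 1"
  shows "(a gchoose i) * Gamma (a + real i + 1)
       = Gamma (a + 1) * ((\<Prod>j=1..i. (- real j + a + 1) * (real j + a)) / fact i)"
proof (induction i)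
  case (Suc i)
  have "a + real i + 1 > 0"
    using assms by linarith
  then have "Gamma (a + real i + 1 + 1) = (a + real i + 1) * Gamma (a + real i + 1)"
    by (intro Gamma_plus1) (auto elim!: nonpos_Ints_cases)
  then have "Gamma (a + real (Suc i) + 1) = (a + real i + 1) * Gamma (a + real i + 1)"
    by (simp add: add_ac)
  moreover have "a gchoose Suc i = (a gchoose i) * (a - real i) / real (Suc i)"
    using gbinomial_absorb_comp[of a i] gbinomial_absorption[of i a] by (simp add: field_simps)
  ultimately have "(a gchoose Suc i) * Gamma (a + real (Suc i) + 1)
      = ((a gchoose i) * Gamma (a + real i + 1)) * ((a - real i) * (a + real i + 1) / real (Suc i))"
    by simp
  also have "\<dots> = Gamma (a + 1) * ((\<Prod>j=1..Suc i. (- real j + a + 1) * (real j + a)) / fact (Suc i))"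
    unfolding Suc.IH by (simp add: algebra_simps)
  finally show ?case .
qed simp

text \<open>The general error bound for n = 6 and a = \<nu> - 1/2, divided by
  \<open>Gamma (a + 1)\<close>. Its three parts are matched with the three stated terms separately,
  the last one with equality.\<close>

lemma bessel_I_five_term_error:
  fixes \<nu> z :: real
  assumes \<nu>: "\<nu> \<ge> 2" and z: "z \<ge> (\<nu> + 11 / 2) ^ 6 / 120"
  shows "\<bar>bessel_I \<nu> z * exp (- z) * sqrt (2 * pi * z)
        - (\<Sum>i=0..5::nat. (\<Prod>j=1..i. (- real j + \<nu> - 1 / 2 + 1) * (real j + \<nu> + 1 / 2 - 1))
              / (fact i * (- 2 * z) ^ i))\<bar>
      \<le> 52 * exp (- z) / (17 * Gamma (\<nu> + 1 / 2))
            * (\<Sum>i=0..5::nat. \<bar>(\<nu> - 1 / 2) gchoose i\<bar> * (z powr (\<nu> - 1 / 2) / 2 ^ i))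
        + exp (- z) / (2 powr (\<nu> - 1 / 2) * Gamma (\<nu> + 1 / 2)) * z powr (\<nu> + 1 / 2)
        + \<bar>(\<nu>\<^sup>2 - 121 / 4) * (\<nu>\<^sup>2 - 81 / 4) * (\<nu>\<^sup>2 - 49 / 4)
              * (\<nu>\<^sup>2 - 25 / 4) * (\<nu>\<^sup>2 - 9 / 4) * (\<nu>\<^sup>2 - 1 / 4)
              / (fact 6 * 2 powr (\<nu> - 1 / 2) * z ^ 6)\<bar>
            * max (2 powr (\<nu> - 13 / 2)) 1"
    (is "\<bar>?X - ?S\<bar> \<le> ?T1 + ?T2 + ?T3")
proof -
  define a where "a = \<nu> - 1 / 2"
  define G where "G = Gamma (a + 1)"
  define Q where "Q i = (\<Prod>j=1..i. (- real j + a + 1) * (real j + a))" for i :: nat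
  have a: "a \<ge> 3 / 2" and \<nu>a: "\<nu> = a + 1 / 2" using \<nu> by (auto simp: a_def)
  have G: "G > 0" unfolding G_def using a by (intro Gamma_real_pos) simp
  \<comment> \<open>Here \<nu> + 11/2 \<ge> 15/2, and (15/2)^5 exceeds 12000 = 100 * 120.\<close>
  have z_ge: "z \<ge> 100 * (\<nu> + 11 / 2)"
  proof -
    have "(15 / 2) ^ 5 \<le> (\<nu> + 11 / 2) ^ 5"
      using \<nu> by (intro power_mono) auto
    then have "(15 / 2) ^ 5 * (\<nu> + 11 / 2) \<le> (\<nu> + 11 / 2) ^ 5 * (\<nu> + 11 / 2)"
      using \<nu> by (intro mult_right_mono) auto
    then have "(15 / 2) ^ 5 * (\<nu> + 11 / 2) \<le> (\<nu> + 11 / 2) ^ 6"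
      by (simp add: eval_nat_numeral)
    then have "12000 * (\<nu> + 11 / 2) \<le> (\<nu> + 11 / 2) ^ 6"
      using \<nu> by (simp add: eval_nat_numeral)
    with z show ?thesis by linarith
  qed
  then have z1: "z \<ge> 1" "z > 0" using \<nu> by auto
  define R1 where "R1 = (\<Sum>i<6. \<bar>a gchoose i\<bar> * (z powr a / 2 ^ i) * (exp (- z) * (z / (z - (a + real i)))))"
  define R2 where "R2 = (z / 2) powr a * exp (- z)"
  define R3 where "R3 = \<bar>a gchoose 6\<bar> / (2 * z) ^ 6 * max 1 (2 powr (real 6 - a)) * Gamma (a + real 6 + 1)"
  have main: "\<bar>G * ?X - (\<Sum>i<6. (a gchoose i) * (- 1 / (2 * z)) ^ i * Gamma (a + real i + 1))\<bar> \<le> R1 + R2 + R3"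
    unfolding R1_def R2_def R3_def G_def \<nu>a
    by (rule bessel_I_asymptotic_error) (use a z1 z_ge \<nu>a in auto)
  have five: "{0..5::nat} = {..<6}"
    by auto
  have S: "(\<Sum>i<6. (a gchoose i) * (- 1 / (2 * z)) ^ i * Gamma (a + real i + 1)) = G * ?S"
    unfolding five sum_distrib_left
  proof (rule sum.cong[OF refl])
    fix i
    have pow: "(- 1 / (2 * z)) ^ i = 1 / (- 2 * z) ^ i"
      unfolding power_one_over[symmetric] by simp
    have "(a gchoose i) * (- 1 / (2 * z)) ^ i * Gamma (a + real i + 1)
        = (a gchoose i) * Gamma (a + real i + 1) * (- 1 / (2 * z)) ^ i"
      by (simp only: mult_ac)
    also have "\<dots> = G * (Q i / fact i) * (- 1 / (2 * z)) ^ i"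
      using gbinomial_mult_Gamma[of a i] a unfolding G_def Q_def by simp
    also have "\<dots> = G * (Q i / (fact i * (- 2 * z) ^ i))"
      unfolding pow by simp
    also have "Q i = (\<Prod>j=1..i. (- real j + \<nu> - 1 / 2 + 1) * (real j + \<nu> + 1 / 2 - 1))"
      unfolding Q_def \<nu>a by (intro prod.cong refl) simp
    finally show "(a gchoose i) * (- 1 / (2 * z)) ^ i * Gamma (a + real i + 1)
        = G * ((\<Prod>j=1..i. (- real j + \<nu> - 1 / 2 + 1) * (real j + \<nu> + 1 / 2 - 1)) / (fact i * (- 2 * z) ^ i))" .
  qed
  have R1: "R1 \<le> G * ?T1"
  proof -
    have "R1 \<le> (\<Sum>i<6. \<bar>a gchoose i\<bar> * (z powr a / 2 ^ i) * (exp (- z) * (52 / 17)))"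
      unfolding R1_def
    proof (intro sum_mono mult_left_mono)
      fix i :: nat assume "i \<in> {..<6}"
      \<comment> \<open>With s = a + i, the bound z/(z - s) \<le> 52/17 amounts to 52s \<le> 35z; it
        follows from \<open>z_ge\<close> because s < a + 6 = \<nu> + 11/2.\<close>
      then have "52 * (a + real i) \<le> 35 * z" "z - (a + real i) > 0"
        using z_ge a unfolding \<nu>a by auto
      then show "z / (z - (a + real i)) \<le> 52 / 17"
        by (simp add: field_simps)
    qed auto
    also have "\<dots> = G * ?T1"
    proof -
      have "\<nu> + 1 / 2 = a + 1" by (simp add: \<nu>a)
      then show ?thesis
        unfolding five sum_distrib_right[symmetric] using G by (simp add: G_def[symmetric] a_def[symmetric])
    qed
    finally show ?thesis .
  qed
  have R2: "R2 \<le> G * ?T2"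
  proof -
    have "R2 = exp (- z) / 2 powr a * (z powr a * 1)"
      using z1 by (simp add: R2_def powr_divide)
    \<comment> \<open>The stated term has exponent \<nu> + 1/2 = a + 1, one more than
      \<open>R2\<close>, so a factor z \<ge> 1 is inserted.\<close>
    also have "\<dots> \<le> exp (- z) / 2 powr a * (z powr a * z powr 1)"
      using z1 by (intro mult_left_mono) auto
    also have "\<dots> = G * ?T2"
    proof -
      have "\<nu> + 1 / 2 = a + 1" by (simp add: \<nu>a)
      then show ?thesis
        unfolding powr_add[symmetric] using G by (simp add: G_def[symmetric] a_def[symmetric])
    qed
    finally show ?thesis .
  qed
  have R3: "R3 = G * ?T3"
  proof -
    have "\<nu> - 13 / 2 - a = - 6" by (simp add: \<nu>a)
    then have "2 powr (\<nu> - 13 / 2) / 2 powr a = 2 powr (- 6)"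
      by (simp flip: powr_diff)
    then have l: "2 powr (\<nu> - 13 / 2) / 2 powr a = 1 / 2 ^ 6"
      by (simp add: powr_minus_divide)
    have "2 powr (real 6 - a) = 2 ^ 6 / 2 powr a"
      by (simp add: powr_diff)
    then have r: "2 powr (real 6 - a) / 2 ^ 6 = 1 / 2 powr a"
      by simp
    \<comment> \<open>Both sides equal the larger of 2^(-6) and 2^(-a); the rescaling swaps the two
      arguments of the maximum.\<close>
    have max: "max 1 (2 powr (real 6 - a)) / 2 ^ 6 = max (2 powr (\<nu> - 13 / 2)) 1 / 2 powr a"
    proof -
      have divide: "max x y / p = max (x / p) (y / p)" if "p > 0" for x y p :: real
        using that by (simp add: max_divide_distrib_right)
      have "max 1 (2 powr (real 6 - a)) / 2 ^ 6 = max (1 / 2 ^ 6) (1 / 2 powr a)"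
        by (subst divide) (simp_all only: r, simp)
      also have "\<dots> = max (2 powr (\<nu> - 13 / 2)) 1 / 2 powr a"
        by (subst divide) (simp_all only: l, simp)
      finally show ?thesis .
    qed
    have "Q 6 = (\<nu>\<^sup>2 - 121 / 4) * (\<nu>\<^sup>2 - 81 / 4) * (\<nu>\<^sup>2 - 49 / 4)
              * (\<nu>\<^sup>2 - 25 / 4) * (\<nu>\<^sup>2 - 9 / 4) * (\<nu>\<^sup>2 - 1 / 4)" (is "_ = ?P")
    proof -
      \<comment> \<open>A difference of squares in \<nu> = a + 1/2; r = 6, ..., 1 gives the
        constants 121/4, ..., 1/4.\<close>
      have factor: "(- r + a + 1) * (r + a) = \<nu>\<^sup>2 - (r - 1 / 2)\<^sup>2" for r
        by (simp add: \<nu>a power2_eq_square algebra_simps)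
      have prod: "(\<Prod>j=1..6. f j) = f 6 * f 5 * f 4 * f 3 * f 2 * f 1" for f :: "nat \<Rightarrow> real"
        by (simp add: eval_nat_numeral mult_ac)
      show ?thesis
        unfolding Q_def factor prod by (simp add: power_divide)
    qed
    then have g: "(a gchoose 6) * Gamma (a + real 6 + 1) = G * (?P / fact 6)"
      using gbinomial_mult_Gamma[of a 6, folded G_def Q_def] a by simp
    have "Gamma (a + real 6 + 1) > 0"
      using a by (intro Gamma_real_pos) simp
    then have "R3 = \<bar>(a gchoose 6) * Gamma (a + real 6 + 1)\<bar> / z ^ 6 * (max 1 (2 powr (real 6 - a)) / 2 ^ 6)"
      by (simp add: R3_def abs_mult power_mult_distrib mult_ac)
    also have "\<dots> = \<bar>G * (?P / fact 6)\<bar> / z ^ 6 * (max (2 powr (\<nu> - 13 / 2)) 1 / 2 powr a)"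
      unfolding g max ..
    also have "\<dots> = G * ?T3"
    proof -
      have aux: "\<bar>G * (p / f)\<bar> / z ^ 6 * (m / d) = G * (\<bar>p / (f * d * z ^ 6)\<bar> * m)"
        if "f > 0" "d > 0" for p f m d
        using that G z1 by (simp add: abs_mult mult_ac)
      show ?thesis
        unfolding a_def by (rule aux) simp_all
    qed
    finally show ?thesis .
  qed
  have "G * \<bar>?X - ?S\<bar> = \<bar>G * ?X - G * ?S\<bar>"
    using G by (simp add: abs_mult flip: right_diff_distrib)
  also have "\<dots> \<le> R1 + R2 + R3"
    using main unfolding S .
  also have "\<dots> \<le> G * ?T1 + G * ?T2 + G * ?T3"
    by (intro add_mono R1 R2 eq_refl[OF R3])
  also have "\<dots> = G * (?T1 + ?T2 + ?T3)"
    by (simp only: distrib_left)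
  finally show ?thesis
    by (rule mult_left_le_imp_le[OF _ G])
qed

section \<open>The case \<nu> = 2\<close>

text \<open>The 18th power of x \<le> exp x at x = z/18 bounds z^18 / 18^18 by exp z. As 324 = 18^2,
  the left side is at least z^9 once z \<ge> 324.\<close>

lemma exp_minus_mult_power_le_1:
  fixes z :: real
  assumes "z \<ge> 324"
  shows "exp (- z) * z ^ 9 \<le> 1"
proof -
  have "z ^ 9 * 1 ^ 9 \<le> z ^ 9 * (z / 324) ^ 9"
    using assms by (intro mult_left_mono power_mono) auto
  also have "\<dots> = (z / 18) ^ 18"
    by (simp add: power_divide flip: power_add)
  also have "\<dots> \<le> exp (z / 18) ^ 18"
    using exp_ge_add_one_self[of "z / 18"] assms by (intro power_mono; linarith)
  also have "\<dots> = exp z"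
    by (simp flip: exp_of_nat_mult)
  finally show ?thesis
    by (simp add: exp_minus field_simps)
qed

text \<open>The two exponentially small terms are absorbed into multiples of 1/z^6; the bounds 7, 1
  and 37 for the three terms add up to 45, within the claimed 73.\<close>

lemma bessel_I_2_error:
  fixes z :: real
  assumes z: "z \<ge> (15 / 2) ^ 6 / 120"
  shows "\<bar>bessel_I 2 z * exp (- z) * sqrt (2 * pi * z)
        - 1 + 15 / (8 * z) - 105 / (128 * z ^ 2) - 315 / (1024 * z ^ 3)
        - 10395 / (32768 * z ^ 4) - 135135 / (262144 * z ^ 5)\<bar> \<le> 73 / z ^ 6"
proof -
  have z324: "z \<ge> 324" using z by (simp add: eval_nat_numeral)
  then have z1: "z \<ge> 1" "z > 0" by auto
  have G: "Gamma (2 + 1 / 2) \<ge> (1::real)"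
  proof -
    have "Gamma (2 + 1 / 2) = sqrt pi * (3 / 4)"
      using Gamma_half_integer[of 2] by (simp add: fact_numeral)
    moreover have "sqrt pi \<ge> 4 / 3"
      using pi_gt3 by (intro real_le_rsqrt) (simp add: power2_eq_square)
    ultimately show ?thesis by simp
  qed
  \<comment> \<open>The powers that occur are 3/2 and 5/2, both at most 3, and exp(-z) z^3 \<le>
    1/z^6 restates exp(-z) z^9 \<le> 1.\<close>
  have small: "exp (- z) * z powr p \<le> 1 / z ^ 6" if "p \<le> 3" for p
  proof -
    have "z powr p \<le> z powr 3"
      using z1 that by (intro powr_mono) auto
    then have "exp (- z) * z powr p \<le> exp (- z) * z ^ 3"
      using z1 by simp
    also have "\<dots> \<le> 1 / z ^ 6"
      using exp_minus_mult_power_le_1[OF z324] z1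
      by (simp add: pos_le_divide_eq mult.assoc flip: power_add)
    finally show ?thesis .
  qed
  have "exp (- z) / Gamma (2 + 1 / 2) * z powr p \<le> 1 / z ^ 6" if "p \<le> 3" for p
  proof -
    have "exp (- z) / Gamma (2 + 1 / 2) * z powr p \<le> exp (- z) * z powr p"
      using G by (intro mult_right_mono) (auto simp: divide_le_eq)
    also note small[OF that]
    finally show ?thesis .
  qed
  note small' = this
  have T1: "52 * exp (- z) / (17 * Gamma (2 + 1 / 2))
            * (\<Sum>i=0..5::nat. \<bar>(2 - 1 / 2) gchoose i\<bar> * (z powr (2 - 1 / 2) / 2 ^ i)) \<le> 7 * (1 / z ^ 6)"
  proof -
    have "(\<Sum>i=0..5::nat. \<bar>(2 - 1 / 2 :: real) gchoose i\<bar> * (1 / 2 ^ i)) \<le> 2"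
      by (simp add: gbinomial_prod_rev eval_nat_numeral)
    then have "52 / 17 * (\<Sum>i=0..5::nat. \<bar>(2 - 1 / 2 :: real) gchoose i\<bar> * (1 / 2 ^ i)) \<le> 7"
      by simp
    then have "52 / 17 * (\<Sum>i=0..5::nat. \<bar>(2 - 1 / 2 :: real) gchoose i\<bar> * (1 / 2 ^ i))
            * (exp (- z) / Gamma (2 + 1 / 2) * z powr (2 - 1 / 2)) \<le> 7 * (1 / z ^ 6)"
      using G by (intro mult_mono small') (auto simp: zero_le_mult_iff)
    then show ?thesis
      by (simp add: sum_distrib_left sum_distrib_right mult_ac)
  qed
  have T2: "exp (- z) / (2 powr (2 - 1 / 2) * Gamma (2 + 1 / 2)) * z powr (2 + 1 / 2) \<le> 1 / z ^ 6"
  proof -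
    have "(2::real) powr (2 - 1 / 2) \<ge> 1"
      by (rule ge_one_powr_ge_zero) auto
    then have "exp (- z) / Gamma (2 + 1 / 2) * z powr (2 + 1 / 2) / 2 powr (2 - 1 / 2)
        \<le> exp (- z) / Gamma (2 + 1 / 2) * z powr (2 + 1 / 2) / 1"
      using G by (intro divide_left_mono) auto
    also have "\<dots> \<le> 1 / z ^ 6"
      using small'[of "2 + 1 / 2"] by simp
    finally show ?thesis
      by (simp add: mult_ac)
  qed
  have T3: "\<bar>(2\<^sup>2 - 121 / 4) * (2\<^sup>2 - 81 / 4) * (2\<^sup>2 - 49 / 4)
              * (2\<^sup>2 - 25 / 4) * (2\<^sup>2 - 9 / 4) * (2\<^sup>2 - 1 / 4)
              / (fact 6 * 2 powr (2 - 1 / 2) * z ^ 6)\<bar>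
            * max (2 powr (2 - 13 / 2)) 1 \<le> 37 * (1 / z ^ 6)"
  proof -
    have max: "max (2 powr (2 - 13 / 2)) 1 = (1::real)"
      using powr_mono[of "2 - 13 / 2" 0 "2::real"] by simp
    \<comment> \<open>Replacing 2^(3/2) by 2 halves the constant 4729725/65536, the absolute value
      of the product over 6!; the half is about 36.1, hence 37.\<close>
    have "(2::real) powr 1 \<le> 2 powr (2 - 1 / 2)"
      by (rule powr_mono) auto
    then have "1 / 2 powr (2 - 1 / 2) * (1 / z ^ 6) \<le> 1 / 2 * (1 / z ^ 6)"
      using z1 by (intro mult_right_mono) (auto simp: field_simps)
    then have "4729725 / 65536 * (1 / 2 powr (2 - 1 / 2) * (1 / z ^ 6)) \<le> 4729725 / 65536 * (1 / 2 * (1 / z ^ 6))"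
      by (rule mult_left_mono) simp
    also have "\<dots> \<le> 37 * (1 / z ^ 6)"
      unfolding mult.assoc[symmetric] using z1 by (intro mult_right_mono) auto
    finally show ?thesis
      unfolding max using z1 by (simp add: abs_mult fact_numeral mult.commute)
  qed
  have S: "(\<Sum>i=0..5::nat. (\<Prod>j=1..i. (- real j + 2 - 1 / 2 + 1) * (real j + 2 + 1 / 2 - 1))
              / (fact i * (- 2 * z) ^ i))
      = 1 - 15 / (8 * z) + 105 / (128 * z ^ 2) + 315 / (1024 * z ^ 3)
        + 10395 / (32768 * z ^ 4) + 135135 / (262144 * z ^ 5)"
  proof -
    have sum: "(\<Sum>i=0..5. f i) = f 0 + f 1 + f 2 + f 3 + f 4 + f 5" for f :: "nat \<Rightarrow> real"
      by (simp add: eval_nat_numeral)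
    define q where "q i = (\<Prod>j=1..i. (- real j + 2 - 1 / 2 + 1) * (real j + 2 + 1 / 2 - 1))" for i :: nat
    \<comment> \<open>The factors 4 - (j - 1/2)^2 are negative from j = 3 on; against the signs of
      (-2z)^i this makes every term from i = 2 on positive.\<close>
    have q: "q 0 = 1" "q 1 = 15 / 4" "q 2 = 105 / 16" "q 3 = - 945 / 64" "q 4 = 31185 / 256"
      "q 5 = - 2027025 / 1024"
      unfolding q_def by (simp_all add: eval_nat_numeral)
    show ?thesis
      unfolding q_def[symmetric] sum q by (simp add: fact_numeral power_mult_distrib)
  qed
  have z': "(2 + 11 / 2) ^ 6 / 120 \<le> z"
    using z by simp
  have "\<bar>bessel_I 2 z * exp (- z) * sqrt (2 * pi * z)
      - (1 - 15 / (8 * z) + 105 / (128 * z ^ 2) + 315 / (1024 * z ^ 3)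
        + 10395 / (32768 * z ^ 4) + 135135 / (262144 * z ^ 5))\<bar> \<le> 7 * (1 / z ^ 6) + 1 / z ^ 6 + 37 * (1 / z ^ 6)"
    using bessel_I_five_term_error[OF order_refl z', unfolded S]
    by (rule order_trans) (intro add_mono T1 T2 T3)
  also have "\<dots> \<le> 73 / z ^ 6"
    using z1 by (simp add: divide_right_mono)
  finally show ?thesis
    by (simp add: algebra_simps)
qed

theorem theorem2p1:
  "(\<forall>(\<nu>::real) (z::real). \<nu> \<ge> 2 \<longrightarrow> z \<ge> (\<nu> + 11 / 2) ^ 6 / 120 \<longrightarrow>
      \<bar>bessel_I \<nu> z * exp (- z) * sqrt (2 * pi * z)
        - (\<Sum>i=0..5::nat. (\<Prod>j=1..i. (- real j + \<nu> - 1 / 2 + 1) * (real j + \<nu> + 1 / 2 - 1))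
              / (fact i * (- 2 * z) ^ i))\<bar>
      \<le> 52 * exp (- z) / (17 * Gamma (\<nu> + 1 / 2))
            * (\<Sum>i=0..5::nat. \<bar>(\<nu> - 1 / 2) gchoose i\<bar> * (z powr (\<nu> - 1 / 2) / 2 ^ i))
        + exp (- z) / (2 powr (\<nu> - 1 / 2) * Gamma (\<nu> + 1 / 2)) * z powr (\<nu> + 1 / 2)
        + \<bar>(\<nu>\<^sup>2 - 121 / 4) * (\<nu>\<^sup>2 - 81 / 4) * (\<nu>\<^sup>2 - 49 / 4)
              * (\<nu>\<^sup>2 - 25 / 4) * (\<nu>\<^sup>2 - 9 / 4) * (\<nu>\<^sup>2 - 1 / 4)
              / (fact 6 * 2 powr (\<nu> - 1 / 2) * z ^ 6)\<bar>
            * max (2 powr (\<nu> - 13 / 2)) 1)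
   \<and> (\<forall>z::real. z \<ge> (15 / 2) ^ 6 / 120 \<longrightarrow>
      \<bar>bessel_I 2 z * exp (- z) * sqrt (2 * pi * z)
        - 1 + 15 / (8 * z) - 105 / (128 * z ^ 2) - 315 / (1024 * z ^ 3)
        - 10395 / (32768 * z ^ 4) - 135135 / (262144 * z ^ 5)\<bar> \<le> 73 / z ^ 6)"
  using bessel_I_five_term_error bessel_I_2_error by blast

end
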